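(* Let $\Omega$ be an infinite set and let $f$ and $g$ be partial-bijections of $\Omega$. Then $\operatorname{ind}(g \circ f) = \operatorname{ind}(g) + \operatorname{ind}(f)$.
   Context: Let $\Omega$ be an infinite set. For $C \subseteq \Omega$ write $C' = \Omega \setminus C$ and $|C|$ for its cardinality. A partial-bijection of $\Omega$ is a bijection $f : A_f \to B_f$ where $A_f, B_f \subseteq \Omega$ are cofinite subsets. The index of $f$ is $\operatorname{ind}(f) = |A_f'| - |B_f'| \in \mathbb{Z}$. For partial-bijections $f : A_f \to B_f$ and $g : A_g \to B_g$, the composite $g \circ f$ is the partial-bijection with domain $A_{g\circ f} = f^{-1}(B_f \cap A_g)$ (preimage under $f$), codomain $B_{g\circ f} = g(B_f \cap A_g)$, and rule $(g\circ f)(\omega) = g(f(\omega))$. *)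

theory Defs
  imports Main
begin

text \<open>
  A function between subsets of \<open>\<Omega>\<close> is a map \<open>f :: 'a \<rightharpoonup> 'a\<close>, with \<open>A\<^sub>f = dom f\<close> and
  \<open>B\<^sub>f = ran f\<close>; as \<open>B\<^sub>f\<close> is the range, bijectivity \<open>A\<^sub>f \<rightarrow> B\<^sub>f\<close> amounts to injectivity on the domain.
\<close>

definition partial_bijection :: "'a set \<Rightarrow> ('a \<rightharpoonup> 'a) \<Rightarrow> bool" where
  "partial_bijection \<Omega> f \<longleftrightarrow>
     dom f \<subseteq> \<Omega> \<and> finite (\<Omega> - dom f) \<and>
     ran f \<subseteq> \<Omega> \<and> finite (\<Omega> - ran f) \<and>
     inj_on f (dom f)"

definition ind :: "'a set \<Rightarrow> ('a \<rightharpoonup> 'a) \<Rightarrow> int" where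
  "ind \<Omega> f = int (card (\<Omega> - dom f)) - int (card (\<Omega> - ran f))"

lemma partial_bijection_bij_betw:
  assumes "partial_bijection \<Omega> f"
  shows "bij_betw (\<lambda>x. the (f x)) (dom f) (ran f)"
  using assms unfolding partial_bijection_def bij_betw_def inj_on_def ran_def dom_def
  by (auto simp: image_iff) force

text \<open>
  The composite of partial bijections is the library's \<open>g \<circ>\<^sub>m f\<close>. The following facts show that it
  has the domain \<open>f\<^sup>-\<^sup>1(B\<^sub>f \<inter> A\<^sub>g)\<close>, the codomain \<open>g(B\<^sub>f \<inter> A\<^sub>g)\<close> and the rule
  \<open>\<omega> \<mapsto> g (f \<omega>)\<close>, and that it is again a partial bijection, so that the cardinalities in its index
  are those of finite sets.
\<close>

lemma dom_map_comp_eq: "dom (g \<circ>\<^sub>m f) = {x \<in> dom f. the (f x) \<in> ran f \<inter> dom g}"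
  by (auto simp: map_comp_def dom_def ran_def split: option.splits)

lemma ran_map_comp_eq: "ran (g \<circ>\<^sub>m f) = (\<lambda>y. the (g y)) ` (ran f \<inter> dom g)"
  by (force simp: map_comp_def dom_def ran_def image_iff split: option.splits)

lemma map_comp_apply:
  assumes "x \<in> dom (g \<circ>\<^sub>m f)"
  shows "the ((g \<circ>\<^sub>m f) x) = the (g (the (f x)))"
  using assms by (auto simp: map_comp_def dom_def split: option.splits)

lemma partial_bijection_map_comp:
  assumes f: "partial_bijection \<Omega> f" and g: "partial_bijection \<Omega> g"
  shows "partial_bijection \<Omega> (g \<circ>\<^sub>m f)"
proof -
  let ?f = "\<lambda>x. the (f x)" and ?g = "\<lambda>x. the (g x)"
  have bf: "bij_betw ?f (dom f) (ran f)" and bg: "bij_betw ?g (dom g) (ran g)"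
    using f g by (auto intro: partial_bijection_bij_betw)
  have sub: "dom f \<subseteq> \<Omega>" "ran f \<subseteq> \<Omega>" "dom g \<subseteq> \<Omega>" "ran g \<subseteq> \<Omega>"
    and fin: "finite (\<Omega> - dom f)" "finite (\<Omega> - ran f)" "finite (\<Omega> - dom g)" "finite (\<Omega> - ran g)"
    using f g by (auto simp: partial_bijection_def)
  have "\<Omega> - dom (g \<circ>\<^sub>m f) \<subseteq> (\<Omega> - dom f) \<union> (?f -` (\<Omega> - dom g) \<inter> dom f)"
    using sub by (auto simp: dom_map_comp_eq ran_def)
  moreover have "finite (?f -` (\<Omega> - dom g) \<inter> dom f)"
    using bf fin by (intro finite_vimage_IntI) (auto simp: bij_betw_def)
  ultimately have d: "finite (\<Omega> - dom (g \<circ>\<^sub>m f))"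
    using fin by (meson finite_UnI finite_subset)
  have "ran g = ?g ` dom g" using bg by (simp add: bij_betw_def)
  then have "\<Omega> - ran (g \<circ>\<^sub>m f) \<subseteq> (\<Omega> - ran g) \<union> ?g ` (\<Omega> - ran f)"
    unfolding ran_map_comp_eq using sub by blast
  then have r: "finite (\<Omega> - ran (g \<circ>\<^sub>m f))"
    using fin by (meson finite_UnI finite_imageI finite_subset)
  have "ran (g \<circ>\<^sub>m f) \<subseteq> ran g" and "dom (g \<circ>\<^sub>m f) \<subseteq> dom f"
    by (auto simp: ran_def dom_def map_comp_def split: option.splits)
  moreover have "inj_on (g \<circ>\<^sub>m f) (dom (g \<circ>\<^sub>m f))"
    using f g unfolding partial_bijection_def inj_on_def
    by (auto simp: map_comp_def dom_def split: option.splits)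
  ultimately show ?thesis
    using sub d r unfolding partial_bijection_def by blast
qed

end

theory Submission imports Defs begin

text \<open>
  With \<open>D = B\<^sub>f \<inter> A\<^sub>g\<close>, the bijections \<open>f\<close> and \<open>g\<close> carry \<open>A\<^sub>f - A\<^bsub>g\<circ>f\<^esub>\<close> onto \<open>B\<^sub>f - D\<close> and \<open>A\<^sub>g - D\<close>
  onto \<open>B\<^sub>g - B\<^bsub>g\<circ>f\<^esub>\<close>. These differences are therefore equinumerous, and they are what separates the
  complements of \<open>A\<^sub>f\<close> and \<open>A\<^bsub>g\<circ>f\<^esub>\<close>, of \<open>B\<^sub>f\<close> and \<open>D\<close>, of \<open>A\<^sub>g\<close> and \<open>D\<close>, and of \<open>B\<^sub>g\<close> and
  \<open>B\<^bsub>g\<circ>f\<^esub>\<close>. Adding up, \<open>|D'|\<close> cancels.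
\<close>

text \<open>Finiteness keeps the sum honest, since \<open>card\<close> is 0 on infinite
  sets.\<close>

lemma card_Diff_chain:
  assumes "S \<subseteq> T" "T \<subseteq> U" "finite (U - S)"
  shows "card (U - S) = card (U - T) + card (T - S)"
proof -
  have "U - S = (U - T) \<union> (T - S)" using assms by blast
  moreover from this have "finite (U - T)" "finite (T - S)" using assms(3) by auto
  moreover have "(U - T) \<inter> (T - S) = {}" by blast
  ultimately show ?thesis by (simp only: card_Un_disjoint)
qed

text \<open>An injective image commutes with differences; if these are infinite, both sides are the
  default 0.\<close>

lemma card_Diff_bij_betw:
  assumes "bij_betw h A B" "S \<subseteq> A"
  shows "card (A - S) = card (B - h ` S)"
proof -
  have "h ` (A - S) = B - h ` S"
    using assms by (simp add: inj_on_image_set_diff[of h A] bij_betw_def)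
  moreover have "inj_on h (A - S)"
    using assms(1) by (meson Diff_subset bij_betw_def inj_on_subset)
  ultimately show ?thesis using card_image[of h "A - S"] by simp
qed

theorem theorem5:
  fixes \<Omega> :: "'a set" and f g :: "'a \<rightharpoonup> 'a"
  assumes "infinite \<Omega>"
    and "partial_bijection \<Omega> f"
    and "partial_bijection \<Omega> g"
  shows "ind \<Omega> (g \<circ>\<^sub>m f) = ind \<Omega> g + ind \<Omega> f"
proof -
  let ?D = "ran f \<inter> dom g" and ?f = "\<lambda>x. the (f x)" and ?g = "\<lambda>y. the (g y)"
  have pf: "dom f \<subseteq> \<Omega>" "ran f \<subseteq> \<Omega>" "finite (\<Omega> - ran f)"
    and pg: "dom g \<subseteq> \<Omega>" "ran g \<subseteq> \<Omega>" "finite (\<Omega> - dom g)"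
    and pc: "finite (\<Omega> - dom (g \<circ>\<^sub>m f))" "finite (\<Omega> - ran (g \<circ>\<^sub>m f))"
    using assms partial_bijection_map_comp[OF assms(2,3)]
    unfolding partial_bijection_def by blast+
  have bf: "bij_betw ?f (dom f) (ran f)" and bg: "bij_betw ?g (dom g) (ran g)"
    by (rule partial_bijection_bij_betw, fact)+
  \<comment> \<open>The domain of the composite is the preimage of \<open>?D\<close> under
    \<open>?f\<close>, and \<open>?D\<close> lies inside \<open>ran f\<close>.\<close>
  have fD: "?f ` dom (g \<circ>\<^sub>m f) = ?D"
  proof -
    have "?f ` {x \<in> dom f. ?f x \<in> ?D} = ?f ` dom f \<inter> ?D"
      by blast
    then show ?thesis
      by (simp only: dom_map_comp_eq bij_betw_imp_surj_on[OF bf] Int_left_absorb)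
  qed
  have dc: "dom (g \<circ>\<^sub>m f) \<subseteq> dom f" unfolding dom_map_comp_eq by (rule Collect_restrict)
  have rc: "ran (g \<circ>\<^sub>m f) \<subseteq> ran g"
    unfolding ran_map_comp_eq bij_betw_imp_surj_on[OF bg, symmetric] by (rule image_mono) simp
  have D: "finite (\<Omega> - ?D)" using pf pg by (simp add: Diff_Int)
  have "card (dom f - dom (g \<circ>\<^sub>m f)) = card (ran f - ?D)"
    using card_Diff_bij_betw[OF bf dc] fD by simp
  moreover have "card (dom g - ?D) = card (ran g - ran (g \<circ>\<^sub>m f))"
    using card_Diff_bij_betw[OF bg, of ?D] by (simp add: ran_map_comp_eq)
  \<comment> \<open>The last two instances count the complement of \<open>?D\<close> through
    \<open>ran f\<close> and through \<open>dom g\<close>.\<close>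
  moreover note card_Diff_chain[OF dc pf(1) pc(1)] card_Diff_chain[OF rc pg(2) pc(2)]
    card_Diff_chain[OF Int_lower1 pf(2) D] card_Diff_chain[OF Int_lower2 pg(1) D]
  ultimately show ?thesis unfolding ind_def by linarith
qed

end
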